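(* Let $R$ be a commutative ring with $1\neq 0$ and let $M$ be a nonzero unital $R$-module that is meet irreducible and finitely generated and all of whose maximal submodules are strongly irreducible. Let $\mathfrak{B}_M$ be the family of all cosets $m+N$ where $m\in M$ and $N$ is a nonzero submodule of $M$ with $N+Rm=M$. Then $\mathfrak{B}_M$ is a basis for a topology on $M$ (denoted $\widetilde{G(M)}$).
   Context: An $R$-module $M$ is meet irreducible if the intersection of any two nonzero submodules of $M$ is nonzero. A submodule $N$ of $M$ is strongly irreducible if whenever $K\cap L\subseteq N$ for submodules $K,L$ of $M$, then $K\subseteq N$ or $L\subseteq N$. *)

theory Defs
  imports "HOL-Analysis.Abstract_Topology" "HOL-Algebra.Module" "HOL-Algebra.AbelCoset"
begin

(* Nothing is assumed about R and M in the definitions below; they are meant to be used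
   under the locale assumption module R M of HOL-Algebra, which already includes that R is a
   commutative ring and that M is unital. *)

definition meet_irreducible ::
    "('r, 'x) ring_scheme \<Rightarrow> ('r, 'm, 'y) module_scheme \<Rightarrow> bool" where
  "meet_irreducible R M \<longleftrightarrow>
     (\<forall>K L. submodule K R M \<longrightarrow> K \<noteq> {\<zero>\<^bsub>M\<^esub>} \<longrightarrow> submodule L R M \<longrightarrow> L \<noteq> {\<zero>\<^bsub>M\<^esub>} \<longrightarrow>
        K \<inter> L \<noteq> {\<zero>\<^bsub>M\<^esub>})"

(* As in the source, a strongly irreducible submodule need not be proper. *)
definition strongly_irreducible ::
    "('r, 'x) ring_scheme \<Rightarrow> ('r, 'm, 'y) module_scheme \<Rightarrow> 'm set \<Rightarrow> bool" where
  "strongly_irreducible R M N \<longleftrightarrow> submodule N R M \<and>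
     (\<forall>K L. submodule K R M \<longrightarrow> submodule L R M \<longrightarrow> K \<inter> L \<subseteq> N \<longrightarrow> K \<subseteq> N \<or> L \<subseteq> N)"

definition maximal_submodule ::
    "('r, 'x) ring_scheme \<Rightarrow> ('r, 'm, 'y) module_scheme \<Rightarrow> 'm set \<Rightarrow> bool" where
  "maximal_submodule R M N \<longleftrightarrow> submodule N R M \<and> N \<noteq> carrier M \<and>
     (\<forall>K. submodule K R M \<longrightarrow> N \<subseteq> K \<longrightarrow> K = N \<or> K = carrier M)"

(* The hull of A is the intersection of all submodules containing A, i.e. the submodule
   generated by A. *)
definition finitely_generated_module ::
    "('r, 'x) ring_scheme \<Rightarrow> ('r, 'm, 'y) module_scheme \<Rightarrow> bool" where
  "finitely_generated_module R M \<longleftrightarrow>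
     (\<exists>A. finite A \<and> A \<subseteq> carrier M \<and> (\<lambda>N. submodule N R M) hull A = carrier M)"

definition cyclic_submodule ::
    "('r, 'x) ring_scheme \<Rightarrow> ('r, 'm, 'y) module_scheme \<Rightarrow> 'm \<Rightarrow> 'm set" where
  "cyclic_submodule R M m = (\<lambda>r. r \<odot>\<^bsub>M\<^esub> m) ` carrier R"

definition coset_family ::
    "('r, 'x) ring_scheme \<Rightarrow> ('r, 'm, 'y) module_scheme \<Rightarrow> 'm set set" where
  "coset_family R M =
     {m <+\<^bsub>M\<^esub> N | m N. m \<in> carrier M \<and> submodule N R M \<and> N \<noteq> {\<zero>\<^bsub>M\<^esub>} \<and>
        N <+>\<^bsub>M\<^esub> cyclic_submodule R M m = carrier M}"

(* The open sets are exactly the unions of (possibly empty) subfamilies of \<B>; this determines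
   the topology T uniquely. *)
definition basis_for_topology_on :: "'a set set \<Rightarrow> 'a set \<Rightarrow> bool" where
  "basis_for_topology_on \<B> X \<longleftrightarrow>
     (\<exists>T. topspace T = X \<and> openin T = arbitrary union_of (\<lambda>U. U \<in> \<B>))"

end

theory Submission
  imports Defs
begin

text \<open>
  The whole module is a member of the family, so only the intersection of two members needs
  attention. If \<open>z\<close> lies in \<open>m + N\<close> and in \<open>m' + N'\<close>, then these cosets are \<open>z + N\<close> and \<open>z + N'\<close>,
  and they meet exactly in \<open>z + (N \<inter> N')\<close>. Meet irreducibility makes \<open>N \<inter> N'\<close> nonzero, so the
  intersection belongs to the family as soon as \<open>(N \<inter> N') + Rz = M\<close>. Hence the family together
  with the empty set is closed under intersection.

  The remaining equation is where maximal submodules enter. Over a finitely generated module,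
  \<open>N + Rz = M\<close> says that no maximal submodule contains both \<open>N\<close> and \<open>z\<close>
  (\<open>add_cyclic_eq_carrier_iff\<close>). A maximal submodule containing \<open>N \<inter> N'\<close> and \<open>z\<close> contains
  \<open>N\<close> or \<open>N'\<close> because it is strongly irreducible, and so contradicts \<open>N + Rz = M\<close> or
  \<open>N' + Rz = M\<close>.
\<close>

section \<open>Maximal submodules of a finitely generated module\<close>

context Module.module
begin

lemma submodule_Int:
  assumes "submodule K R M" and "submodule L R M"
  shows "submodule (K \<inter> L) R M"
proof (rule submoduleI)
  show "K \<inter> L \<subseteq> carrier M"
    using submoduleE(1)[OF assms(1)] by blast
  show "\<zero>\<^bsub>M\<^esub> \<in> K \<inter> L"
    using assms[THEN submodule.axioms(1), THEN subgroup.one_closed] by simp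
qed (use submoduleE(3-5)[OF assms(1)] submoduleE(3-5)[OF assms(2)] in simp_all)

lemma submodule_Union_chain:
  assumes "\<C> \<noteq> {}" and chain: "subset.chain {N. submodule N R M} \<C>"
  shows "submodule (\<Union>\<C>) R M"
proof (rule submoduleI)
  have sub: "submodule C R M" if "C \<in> \<C>" for C
    using chain that by (auto simp: subset.chain_def)
  show "\<Union>\<C> \<subseteq> carrier M"
    using submoduleE(1)[OF sub] by blast
  obtain C where "C \<in> \<C>"
    using \<open>\<C> \<noteq> {}\<close> by blast
  then show "\<zero>\<^bsub>M\<^esub> \<in> \<Union>\<C>"
    using subgroup.one_closed[OF submodule.axioms(1)[OF sub]] by auto
  show "a \<oplus>\<^bsub>M\<^esub> b \<in> \<Union>\<C>" if ab: "a \<in> \<Union>\<C>" "b \<in> \<Union>\<C>" for a b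
  proof -
    obtain B where "B \<in> \<C>" "{a, b} \<subseteq> B"
      using finite_subset_Union_chain[of "{a, b}" \<C>] ab assms by auto
    then show ?thesis
      using submoduleE(5)[OF sub] by blast
  qed
  show "\<ominus>\<^bsub>M\<^esub> a \<in> \<Union>\<C>" if "a \<in> \<Union>\<C>" for a
    using that submoduleE(3)[OF sub] by blast
  show "r \<odot>\<^bsub>M\<^esub> x \<in> \<Union>\<C>" if "r \<in> carrier R" "x \<in> \<Union>\<C>" for r x
    using that submoduleE(4)[OF sub] by blast
qed

text \<open>
  Zorn's lemma applies to the proper submodules above \<open>K\<close>: if the union of a chain were the whole
  module, then the finitely many generators would already lie in a single member of the chain.
\<close>

lemma proper_submodule_le_maximal:
  assumes fg: "finitely_generated_module R M"
    and K: "submodule K R M" "K \<noteq> carrier M"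
  obtains P where "maximal_submodule R M P" "K \<subseteq> P"
proof -
  obtain A where A: "finite A" "A \<subseteq> carrier M"
    and hull: "(\<lambda>N. submodule N R M) hull A = carrier M"
    using fg by (auto simp: finitely_generated_module_def)
  have generates: "C = carrier M" if "submodule C R M" "A \<subseteq> C" for C
    using hull_minimal[OF that(2), of "\<lambda>N. submodule N R M"] that(1) hull submoduleE(1)[OF that(1)] by simp
  define \<A> where "\<A> = {N. submodule N R M \<and> K \<subseteq> N \<and> N \<noteq> carrier M}"
  have "\<exists>P\<in>\<A>. \<forall>X\<in>\<A>. P \<subseteq> X \<longrightarrow> X = P"
  proof (rule subset_Zorn_nonempty)
    show "\<A> \<noteq> {}"
      using K by (auto simp: \<A>_def)
    show "\<Union>\<C> \<in> \<A>" if "\<C> \<noteq> {}" and chain: "subset.chain \<A> \<C>" for \<C>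
    proof -
      have "\<C> \<subseteq> \<A>"
        using chain by (simp add: subset.chain_def)
      have "subset.chain {N. submodule N R M} \<C>"
        using chain unfolding subset_chain_def \<A>_def by blast
      then have "submodule (\<Union>\<C>) R M"
        using submodule_Union_chain[OF \<open>\<C> \<noteq> {}\<close>] by simp
      moreover have "K \<subseteq> \<Union>\<C>"
        using \<open>\<C> \<noteq> {}\<close> \<open>\<C> \<subseteq> \<A>\<close> by (auto simp: \<A>_def)
      moreover have "\<Union>\<C> \<noteq> carrier M"
      proof
        assume "\<Union>\<C> = carrier M"
        then obtain C where "C \<in> \<C>" "A \<subseteq> C"
          using finite_subset_Union_chain[OF A(1) _ \<open>\<C> \<noteq> {}\<close> chain] A(2) by metis
        then show False
          using generates \<open>\<C> \<subseteq> \<A>\<close> by (auto simp: \<A>_def)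
      qed
      ultimately show ?thesis
        by (simp add: \<A>_def)
    qed
  qed
  then obtain P where "P \<in> \<A>" and max: "\<And>X. X \<in> \<A> \<Longrightarrow> P \<subseteq> X \<Longrightarrow> X = P"
    by blast
  then have "maximal_submodule R M P" "K \<subseteq> P"
    by (auto simp: maximal_submodule_def \<A>_def)
  then show thesis
    by (rule that)
qed

section \<open>Submodules that generate the module together with one element\<close>

lemma submodule_add_cyclic:
  assumes N: "submodule N R M" and m: "m \<in> carrier M"
  shows "submodule (N <+>\<^bsub>M\<^esub> cyclic_submodule R M m) R M"
proof -
  have sum: "N <+>\<^bsub>M\<^esub> cyclic_submodule R M m = {n \<oplus>\<^bsub>M\<^esub> r \<odot>\<^bsub>M\<^esub> m | n r. n \<in> N \<and> r \<in> carrier R}"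
    by (auto simp: set_add_def' cyclic_submodule_def)
  have N_carrier: "n \<in> carrier M" if "n \<in> N" for n
    using that submoduleE(1)[OF N] by blast
  show ?thesis
    unfolding sum
  proof (rule submoduleI)
    show "{n \<oplus>\<^bsub>M\<^esub> r \<odot>\<^bsub>M\<^esub> m | n r. n \<in> N \<and> r \<in> carrier R} \<subseteq> carrier M"
      using N_carrier m by auto
    have "\<zero>\<^bsub>M\<^esub> = \<zero>\<^bsub>M\<^esub> \<oplus>\<^bsub>M\<^esub> \<zero> \<odot>\<^bsub>M\<^esub> m" "\<zero>\<^bsub>M\<^esub> \<in> N"
      using m subgroup.one_closed[OF submodule.axioms(1)[OF N]] by auto
    then show "\<zero>\<^bsub>M\<^esub> \<in> {n \<oplus>\<^bsub>M\<^esub> r \<odot>\<^bsub>M\<^esub> m | n r. n \<in> N \<and> r \<in> carrier R}"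
      by blast
  next
    fix a assume "a \<in> {n \<oplus>\<^bsub>M\<^esub> r \<odot>\<^bsub>M\<^esub> m | n r. n \<in> N \<and> r \<in> carrier R}"
    then obtain n r where a: "a = n \<oplus>\<^bsub>M\<^esub> r \<odot>\<^bsub>M\<^esub> m" "n \<in> N" "r \<in> carrier R"
      by blast
    have "\<ominus>\<^bsub>M\<^esub> a = \<ominus>\<^bsub>M\<^esub> n \<oplus>\<^bsub>M\<^esub> (\<ominus> r) \<odot>\<^bsub>M\<^esub> m"
      using a m N_carrier by (simp add: M.minus_add smult_l_minus)
    then show "\<ominus>\<^bsub>M\<^esub> a \<in> {n \<oplus>\<^bsub>M\<^esub> r \<odot>\<^bsub>M\<^esub> m | n r. n \<in> N \<and> r \<in> carrier R}"
      using a submoduleE(3)[OF N] by blast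
    fix b assume "b \<in> {n \<oplus>\<^bsub>M\<^esub> r \<odot>\<^bsub>M\<^esub> m | n r. n \<in> N \<and> r \<in> carrier R}"
    then obtain n' r' where b: "b = n' \<oplus>\<^bsub>M\<^esub> r' \<odot>\<^bsub>M\<^esub> m" "n' \<in> N" "r' \<in> carrier R"
      by blast
    have "a \<oplus>\<^bsub>M\<^esub> b = (n \<oplus>\<^bsub>M\<^esub> n') \<oplus>\<^bsub>M\<^esub> (r \<oplus> r') \<odot>\<^bsub>M\<^esub> m"
      using a b m N_carrier by (simp add: smult_l_distr M.a_ac)
    then show "a \<oplus>\<^bsub>M\<^esub> b \<in> {n \<oplus>\<^bsub>M\<^esub> r \<odot>\<^bsub>M\<^esub> m | n r. n \<in> N \<and> r \<in> carrier R}"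
      using a b submoduleE(5)[OF N] by blast
  next
    fix s x assume s: "s \<in> carrier R" and "x \<in> {n \<oplus>\<^bsub>M\<^esub> r \<odot>\<^bsub>M\<^esub> m | n r. n \<in> N \<and> r \<in> carrier R}"
    then obtain n r where x: "x = n \<oplus>\<^bsub>M\<^esub> r \<odot>\<^bsub>M\<^esub> m" "n \<in> N" "r \<in> carrier R"
      by blast
    have "s \<odot>\<^bsub>M\<^esub> x = s \<odot>\<^bsub>M\<^esub> n \<oplus>\<^bsub>M\<^esub> (s \<otimes> r) \<odot>\<^bsub>M\<^esub> m"
      using x s m N_carrier by (simp add: smult_r_distr smult_assoc1)
    then show "s \<odot>\<^bsub>M\<^esub> x \<in> {n \<oplus>\<^bsub>M\<^esub> r \<odot>\<^bsub>M\<^esub> m | n r. n \<in> N \<and> r \<in> carrier R}"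
      using x s submoduleE(4)[OF N] by blast
  qed
qed

lemma add_cyclic_subset_iff:
  assumes N: "submodule N R M" and m: "m \<in> carrier M" and P: "submodule P R M"
  shows "N <+>\<^bsub>M\<^esub> cyclic_submodule R M m \<subseteq> P \<longleftrightarrow> N \<subseteq> P \<and> m \<in> P"
proof
  assume sub: "N <+>\<^bsub>M\<^esub> cyclic_submodule R M m \<subseteq> P"
  have mem: "n \<oplus>\<^bsub>M\<^esub> r \<odot>\<^bsub>M\<^esub> m \<in> P" if "n \<in> N" "r \<in> carrier R" for n r
    using sub that by (auto simp: set_add_def' cyclic_submodule_def)
  have "n \<in> P" if "n \<in> N" for n
    using mem[OF that R.zero_closed] subsetD[OF submoduleE(1)[OF N] that] m by simp
  moreover have "m \<in> P"
    using mem[OF subgroup.one_closed[OF submodule.axioms(1)[OF N]] R.one_closed] m by simp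
  ultimately show "N \<subseteq> P \<and> m \<in> P"
    by blast
next
  assume "N \<subseteq> P \<and> m \<in> P"
  then show "N <+>\<^bsub>M\<^esub> cyclic_submodule R M m \<subseteq> P"
    by (auto simp: set_add_def' cyclic_submodule_def subset_iff
        intro!: submoduleE(5)[OF P] submoduleE(4)[OF P])
qed

text \<open>
  This turns the generation condition on \<open>m + N\<close> into a condition on maximal submodules, in which
  \<open>m\<close> may be replaced by any other representative of the coset, and to which strong irreducibility
  applies.
\<close>

lemma add_cyclic_eq_carrier_iff:
  assumes fg: "finitely_generated_module R M"
    and N: "submodule N R M" and m: "m \<in> carrier M"
  shows "N <+>\<^bsub>M\<^esub> cyclic_submodule R M m = carrier M \<longleftrightarrow>
    (\<forall>P. maximal_submodule R M P \<longrightarrow> N \<subseteq> P \<longrightarrow> m \<notin> P)"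
    (is "?S = _ \<longleftrightarrow> ?rhs")
proof
  assume S: "?S = carrier M"
  show ?rhs
  proof (intro allI impI notI)
    fix P assume P: "maximal_submodule R M P" "N \<subseteq> P" "m \<in> P"
    then have "submodule P R M" "P \<noteq> carrier M"
      by (simp_all add: maximal_submodule_def)
    then have "carrier M \<subseteq> P" "P \<subseteq> carrier M"
      using add_cyclic_subset_iff[OF N m] S P(2,3) submoduleE(1) by simp_all
    then show False
      using \<open>P \<noteq> carrier M\<close> by simp
  qed
next
  assume no_max: ?rhs
  show "?S = carrier M"
  proof (rule ccontr)
    assume "?S \<noteq> carrier M"
    then obtain P where P: "maximal_submodule R M P" "?S \<subseteq> P"
      using proper_submodule_le_maximal[OF fg submodule_add_cyclic[OF N m]] by blast
    then have "N \<subseteq> P" "m \<in> P"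
      using add_cyclic_subset_iff[OF N m] by (simp_all add: maximal_submodule_def)
    then show False
      using no_max P(1) by simp
  qed
qed

lemma add_cyclic_l_coset_repr:
  assumes fg: "finitely_generated_module R M"
    and N: "submodule N R M" and m: "m \<in> carrier M"
    and z: "z \<in> m <+\<^bsub>M\<^esub> N"
    and gen: "N <+>\<^bsub>M\<^esub> cyclic_submodule R M m = carrier M"
  shows "N <+>\<^bsub>M\<^esub> cyclic_submodule R M z = carrier M"
proof -
  have z_carrier: "z \<in> carrier M"
    using M.a_l_coset_carrier[OF z m submodule.axioms(1)[OF N]] .
  have "m \<in> z <+\<^bsub>M\<^esub> N"
    using M.a_l_coset_swap[OF z m submodule.axioms(1)[OF N]] .
  then obtain n where "n \<in> N" "m = z \<oplus>\<^bsub>M\<^esub> n"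
    by (auto simp: a_l_coset_def')
  then have "m \<in> P" if "maximal_submodule R M P" "N \<subseteq> P" "z \<in> P" for P
    using that submoduleE(5)[of P z n] unfolding maximal_submodule_def by blast
  then show ?thesis
    using gen unfolding add_cyclic_eq_carrier_iff[OF fg N m]
      add_cyclic_eq_carrier_iff[OF fg N z_carrier] by blast
qed

lemma l_coset_Int:
  assumes "K \<subseteq> carrier M" "L \<subseteq> carrier M" and "z \<in> carrier M"
  shows "(z <+\<^bsub>M\<^esub> K) \<inter> (z <+\<^bsub>M\<^esub> L) = z <+\<^bsub>M\<^esub> (K \<inter> L)"
proof -
  have "k = l" if "k \<in> K" "l \<in> L" "z \<oplus>\<^bsub>M\<^esub> k = z \<oplus>\<^bsub>M\<^esub> l" for k l
    using that assms subsetD[OF assms(1) that(1)] subsetD[OF assms(2) that(2)] by simp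
  then show ?thesis
    unfolding a_l_coset_def' by blast
qed

text \<open>
  The step that uses strong irreducibility: a maximal submodule above \<open>K \<inter> L\<close> is above one of
  the two, so if it also contained \<open>z\<close> then \<open>K + Rz\<close> or \<open>L + Rz\<close> would be proper.
\<close>

lemma add_cyclic_Int:
  assumes fg: "finitely_generated_module R M"
    and strong: "\<And>P. maximal_submodule R M P \<Longrightarrow> strongly_irreducible R M P"
    and K: "submodule K R M" and L: "submodule L R M" and z: "z \<in> carrier M"
    and gen: "K <+>\<^bsub>M\<^esub> cyclic_submodule R M z = carrier M"
      "L <+>\<^bsub>M\<^esub> cyclic_submodule R M z = carrier M"
  shows "(K \<inter> L) <+>\<^bsub>M\<^esub> cyclic_submodule R M z = carrier M"
proof -
  have "K \<subseteq> P \<or> L \<subseteq> P" if "maximal_submodule R M P" "K \<inter> L \<subseteq> P" for P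
    using strong[OF that(1)] K L that(2) by (simp add: strongly_irreducible_def)
  then show ?thesis
    using gen unfolding add_cyclic_eq_carrier_iff[OF fg K z] add_cyclic_eq_carrier_iff[OF fg L z]
      add_cyclic_eq_carrier_iff[OF fg submodule_Int[OF K L] z] by blast
qed

section \<open>The family of cosets is a basis\<close>

lemma coset_family_Int:
  assumes mi: "meet_irreducible R M"
    and fg: "finitely_generated_module R M"
    and strong: "\<And>P. maximal_submodule R M P \<Longrightarrow> strongly_irreducible R M P"
    and U: "U \<in> coset_family R M" and V: "V \<in> coset_family R M"
    and ne: "U \<inter> V \<noteq> {}"
  shows "U \<inter> V \<in> coset_family R M"
proof -
  obtain m N where U_eq: "U = m <+\<^bsub>M\<^esub> N" and m: "m \<in> carrier M"
    and N: "submodule N R M" "N \<noteq> {\<zero>\<^bsub>M\<^esub>}" "N <+>\<^bsub>M\<^esub> cyclic_submodule R M m = carrier M"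
    using U by (auto simp: coset_family_def)
  obtain m' N' where V_eq: "V = m' <+\<^bsub>M\<^esub> N'" and m': "m' \<in> carrier M"
    and N': "submodule N' R M" "N' \<noteq> {\<zero>\<^bsub>M\<^esub>}" "N' <+>\<^bsub>M\<^esub> cyclic_submodule R M m' = carrier M"
    using V by (auto simp: coset_family_def)
  obtain z where z: "z \<in> m <+\<^bsub>M\<^esub> N" "z \<in> m' <+\<^bsub>M\<^esub> N'"
    using ne U_eq V_eq by blast
  have zc: "z \<in> carrier M"
    using M.a_l_coset_carrier[OF z(1) m submodule.axioms(1)[OF N(1)]] .
  have "U = z <+\<^bsub>M\<^esub> N" "V = z <+\<^bsub>M\<^esub> N'"
    using M.a_l_repr_independence[OF z(1) m submodule.axioms(1)[OF N(1)]]
      M.a_l_repr_independence[OF z(2) m' submodule.axioms(1)[OF N'(1)]] U_eq V_eq by simp_all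
  then have "U \<inter> V = z <+\<^bsub>M\<^esub> (N \<inter> N')"
    using l_coset_Int zc submoduleE(1) N(1) N'(1) by simp
  moreover have "submodule (N \<inter> N') R M"
    using submodule_Int N(1) N'(1) .
  moreover have "N \<inter> N' \<noteq> {\<zero>\<^bsub>M\<^esub>}"
    using mi N N' by (simp add: meet_irreducible_def)
  moreover have "(N \<inter> N') <+>\<^bsub>M\<^esub> cyclic_submodule R M z = carrier M"
    using add_cyclic_Int[OF fg strong N(1) N'(1) zc]
      add_cyclic_l_coset_repr[OF fg N(1) m z(1) N(3)]
      add_cyclic_l_coset_repr[OF fg N'(1) m' z(2) N'(3)] by simp
  ultimately show ?thesis
    using zc unfolding coset_family_def by blast
qed

lemma carrier_in_coset_family:
  assumes "carrier M \<noteq> {\<zero>\<^bsub>M\<^esub>}"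
  shows "carrier M \<in> coset_family R M"
proof -
  have "\<zero>\<^bsub>M\<^esub> <+\<^bsub>M\<^esub> carrier M = carrier M"
    by (simp add: M.a_lcos_mult_one)
  moreover have "carrier M <+>\<^bsub>M\<^esub> cyclic_submodule R M \<zero>\<^bsub>M\<^esub> = carrier M"
    using add_cyclic_subset_iff[OF carrier_is_submodule M.zero_closed
        submodule_add_cyclic[OF carrier_is_submodule M.zero_closed]]
      submoduleE(1)[OF submodule_add_cyclic[OF carrier_is_submodule M.zero_closed]] by auto
  ultimately show ?thesis
    unfolding coset_family_def mem_Collect_eq
    using assms carrier_is_submodule
    by (intro exI[of _ "\<zero>\<^bsub>M\<^esub>"] exI[of _ "carrier M"]) simp
qed

lemma coset_family_subset_carrier:
  assumes "U \<in> coset_family R M"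
  shows "U \<subseteq> carrier M"
proof -
  obtain m N where "U = m <+\<^bsub>M\<^esub> N" "m \<in> carrier M" "submodule N R M"
    using assms unfolding coset_family_def by blast
  then show ?thesis
    using M.a_l_coset_subset_G[OF submoduleE(1)] by simp
qed

end

lemma basis_for_topology_onI:
  assumes Int: "\<And>U V. U \<in> \<B> \<Longrightarrow> V \<in> \<B> \<Longrightarrow> U \<inter> V \<noteq> {} \<Longrightarrow> U \<inter> V \<in> \<B>"
    and Un: "\<Union>\<B> = X"
  shows "basis_for_topology_on \<B> X"
proof -
  let ?T = "topology (arbitrary union_of (\<lambda>U. U \<in> \<B>))"
  have "(arbitrary union_of (\<lambda>U. U \<in> \<B>)) (U \<inter> V)" if "U \<in> \<B>" "V \<in> \<B>" for U V
    \<comment> \<open>An empty intersection is the union of the empty subfamily.\<close>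
    using Int[OF that] by (cases "U \<inter> V = {}") (simp_all add: arbitrary_union_of_inc)
  then have openin: "openin ?T = arbitrary union_of (\<lambda>U. U \<in> \<B>)"
    by (simp add: istopology_base_eq)
  have "topspace ?T = X"
  proof
    have "(arbitrary union_of (\<lambda>U. U \<in> \<B>)) (topspace ?T)"
      using openin_topspace[of ?T] unfolding openin .
    then show "topspace ?T \<subseteq> X"
      unfolding union_of_def using Un by blast
    have "openin ?T U" if "U \<in> \<B>" for U
      using that unfolding openin by (rule arbitrary_union_of_inc)
    then show "X \<subseteq> topspace ?T"
      using Un openin_subset by blast
  qed
  with openin show ?thesis
    unfolding basis_for_topology_on_def by (intro exI[of _ ?T]) simp
qed

theorem theorem2:
  fixes R :: "('r, 'x) ring_scheme" and M :: "('r, 'm, 'y) module_scheme"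
  assumes "Module.module R M"
    and "\<one>\<^bsub>R\<^esub> \<noteq> \<zero>\<^bsub>R\<^esub>"
    and "carrier M \<noteq> {\<zero>\<^bsub>M\<^esub>}"
    and "meet_irreducible R M"
    and "finitely_generated_module R M"
    and "\<And>N. maximal_submodule R M N \<Longrightarrow> strongly_irreducible R M N"
  shows "basis_for_topology_on (coset_family R M) (carrier M)"
proof (rule basis_for_topology_onI)
  interpret Module.module R M
    by fact
  show "U \<inter> V \<in> coset_family R M"
    if "U \<in> coset_family R M" "V \<in> coset_family R M" "U \<inter> V \<noteq> {}" for U V
    using coset_family_Int[OF assms(4-6) that] .
  show "\<Union>(coset_family R M) = carrier M"
    using carrier_in_coset_family[OF assms(3)] coset_family_subset_carrier
    by (simp add: Union_upper Union_least subset_antisym)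
qed

end
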